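(* Let $\mathcal{S}$ be a separable metric space, $\mu$ a Borel probability measure on $\mathcal{S}$, and $\kappa:\mathcal{S}\times\mathcal{S}\to[0,\infty)$ a symmetric kernel with $\kappa\in L^1(\mathcal{S}\times\mathcal{S},\mu\otimes\mu)$. If $\lambda_2\in L^2(\mathcal{S},\mu)$ and $\lambda_*<1$, then $G(n,\kappa)$ is disconnected with high probability, i.e. $\mathbb{P}(G(n,\kappa)\text{ is disconnected})\to1$ as $n\to\infty$.
   Context: Let $X_1,\dots,X_n$ be independent $\mu$-distributed random points of $\mathcal{S}$ and $p_n=\log n/n$. The random graph $G(n,\kappa)=(V_n,E_n)$ has vertex set $V_n=\{1,\dots,n\}$; given $X_1,\dots,X_n$, each pair $i\ne j$ is joined by an edge independently with probability $p_{ij}=\min\{1,\kappa(X_i,X_j)p_n\}$. $\lambda(x)=\int_{\mathcal{S}}\kappa(x,y)\,d\mu(y)$, $\lambda_2(x)=\left(\int_{\mathcal{S}}\kappa(x,y)^2\,d\mu(y)\right)^{1/2}$, and $\lambda_*=\operatorname{ess\,inf}_{x}\lambda(x)$ (essential infimum with respect to $\mu$). *)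

theory Defs
  imports "HOL-Probability.Probability"
begin

text \<open>
  An undirected simple graph is a pair \<open>(V, E)\<close> of a vertex set and a set of two-element
  subsets of \<open>V\<close>.
\<close>

type_synonym 'v graph = "'v set \<times> 'v set set"

definition graph_connected :: "'v graph \<Rightarrow> bool" where
  "graph_connected G \<longleftrightarrow>
     (\<forall>u\<in>fst G. \<forall>v\<in>fst G. (u, v) \<in> {(a, b). a \<noteq> b \<and> {a, b} \<in> snd G}\<^sup>*)"

definition edge_scale :: "nat \<Rightarrow> real" where
  "edge_scale n = ln (real n) / real n"

definition edge_prob :: "('a \<Rightarrow> 'a \<Rightarrow> real) \<Rightarrow> nat \<Rightarrow> 'a \<Rightarrow> 'a \<Rightarrow> real" where
  "edge_prob \<kappa> n x y = min 1 (\<kappa> x y * edge_scale n)"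

text \<open>Each unordered pair of distinct vertices is represented once, by its increasing listing.\<close>

definition vertex_pairs :: "nat \<Rightarrow> (nat \<times> nat) set" where
  "vertex_pairs n = {(i, j). 1 \<le> i \<and> i < j \<and> j \<le> n}"

text \<open>The conditional law of the graph given the points \<open>x 1, \<dots>, x n\<close>.\<close>

definition graph_given_points ::
  "('a \<Rightarrow> 'a \<Rightarrow> real) \<Rightarrow> nat \<Rightarrow> (nat \<Rightarrow> 'a) \<Rightarrow> nat graph pmf" where
  "graph_given_points \<kappa> n x =
     map_pmf (\<lambda>b. ({1..n}, {{i, j} | i j. (i, j) \<in> vertex_pairs n \<and> b (i, j)}))
       (Pi_pmf (vertex_pairs n) False (\<lambda>(i, j). bernoulli_pmf (edge_prob \<kappa> n (x i) (x j))))"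

text \<open>
  The law of \<open>G(n, \<kappa>)\<close>: sample the points from the \<open>n\<close>-fold product of \<open>\<mu>\<close>, then sample the
  graph from its conditional law.
\<close>

definition random_graph ::
  "'a measure \<Rightarrow> ('a \<Rightarrow> 'a \<Rightarrow> real) \<Rightarrow> nat \<Rightarrow> nat graph measure" where
  "random_graph \<mu> \<kappa> n =
     Pi\<^sub>M {1..n} (\<lambda>_. \<mu>) \<bind> (\<lambda>x. measure_pmf (graph_given_points \<kappa> n x))"

text \<open>
  The functions \<open>\<lambda>\<close> and \<open>\<lambda>\<^sub>2\<close> may take the value \<open>\<infinity>\<close>, so they are extended-real valued; the
  Bochner integral would return 0 at points where the integral diverges.
\<close>

definition ennsqrt :: "ennreal \<Rightarrow> ennreal" where
  "ennsqrt t = (if t = \<top> then \<top> else ennreal (sqrt (enn2real t)))"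

definition kernel_deg :: "'a measure \<Rightarrow> ('a \<Rightarrow> 'a \<Rightarrow> real) \<Rightarrow> 'a \<Rightarrow> ennreal" where
  "kernel_deg \<mu> \<kappa> x = (\<integral>\<^sup>+ y. ennreal (\<kappa> x y) \<partial>\<mu>)"

definition kernel_deg2 :: "'a measure \<Rightarrow> ('a \<Rightarrow> 'a \<Rightarrow> real) \<Rightarrow> 'a \<Rightarrow> ennreal" where
  "kernel_deg2 \<mu> \<kappa> x = ennsqrt (\<integral>\<^sup>+ y. ennreal ((\<kappa> x y)\<^sup>2) \<partial>\<mu>)"

definition in_L2 :: "'a measure \<Rightarrow> ('a \<Rightarrow> ennreal) \<Rightarrow> bool" where
  "in_L2 M f \<longleftrightarrow> f \<in> borel_measurable M \<and> (\<integral>\<^sup>+ x. (f x)\<^sup>2 \<partial>M) < \<top>"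

definition essinf :: "'a measure \<Rightarrow> ('a \<Rightarrow> ennreal) \<Rightarrow> ennreal" where
  "essinf M f = Sup {z. AE x in M. z \<le> f x}"

lemma ennsqrt_power2: "(ennsqrt t)\<^sup>2 = t"
  by (cases t) (auto simp: ennsqrt_def ennreal_power)

lemma finite_vertex_pairs: "finite (vertex_pairs n)"
  by (rule finite_subset[of _ "{1..n} \<times> {1..n}"]) (auto simp: vertex_pairs_def)

lemma edge_prob_bounds:
  assumes "\<And>x y. 0 \<le> \<kappa> x y"
  shows "0 \<le> edge_prob \<kappa> n x y" "edge_prob \<kappa> n x y \<le> 1"
  using assms by (auto simp: edge_prob_def edge_scale_def ln_ge_zero_iff)
    (cases n; auto intro!: mult_nonneg_nonneg divide_nonneg_nonneg)

lemma measurable_graph_given_points: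
  fixes \<kappa> :: "'a \<Rightarrow> 'a \<Rightarrow> real"
  assumes [measurable]: "case_prod \<kappa> \<in> borel_measurable (\<mu> \<Otimes>\<^sub>M \<mu>)"
    and nonneg: "\<And>x y. 0 \<le> \<kappa> x y"
  shows "(\<lambda>x. measure_pmf (graph_given_points \<kappa> n x))
           \<in> Pi\<^sub>M {1..n} (\<lambda>_. \<mu>) \<rightarrow>\<^sub>M subprob_algebra (count_space UNIV)"
proof (rule measurable_subprob_algebra)
  fix A :: "nat graph set"
  let ?g = "\<lambda>b. ({1..n}, {{i, j} | i j. (i, j) \<in> vertex_pairs n \<and> b (i, j)})"
  let ?P = "\<lambda>x. Pi_pmf (vertex_pairs n) False
              (\<lambda>(i, j). bernoulli_pmf (edge_prob \<kappa> n (x i) (x j)))"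
  let ?B = "{b. \<forall>e. e \<notin> vertex_pairs n \<longrightarrow> \<not> b e} \<inter> ?g -` A"
  have "finite {b :: nat \<times> nat \<Rightarrow> bool. \<forall>e. e \<notin> vertex_pairs n \<longrightarrow> \<not> b e}"
    using finite_PiE_dflt[OF finite_vertex_pairs[of n], of "\<lambda>_. UNIV :: bool set" False]
    by (simp add: PiE_dflt_def)
  hence fin: "finite ?B"
    by (rule finite_Int[OF disjI1])
  have eq: "emeasure (measure_pmf (graph_given_points \<kappa> n x)) A =
          (\<Sum>b\<in>?B. \<Prod>(i, j)\<in>vertex_pairs n. ennreal
            (if b (i, j) then edge_prob \<kappa> n (x i) (x j) else 1 - edge_prob \<kappa> n (x i) (x j)))" for x
  proof -
    have "emeasure (measure_pmf (graph_given_points \<kappa> n x)) A = emeasure (?P x) (?g -` A)"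
      by (simp add: graph_given_points_def)
    also have "\<dots> = emeasure (?P x) ?B"
    proof (rule emeasure_eq_AE)
      have "set_pmf (?P x) \<subseteq> {b. \<forall>e. e \<notin> vertex_pairs n \<longrightarrow> b e = False}"
        by (rule set_Pi_pmf_subset[OF finite_vertex_pairs])
      thus "AE b in measure_pmf (?P x). b \<in> ?g -` A \<longleftrightarrow> b \<in> ?B"
        unfolding AE_measure_pmf_iff by blast
    qed simp_all
    also have "\<dots> = (\<Sum>b\<in>?B. ennreal (pmf (?P x) b))"
      by (simp only: emeasure_measure_pmf_finite[OF fin] sum_ennreal[OF pmf_nonneg])
    also have "\<dots> = (\<Sum>b\<in>?B. \<Prod>(i, j)\<in>vertex_pairs n. ennreal
            (if b (i, j) then edge_prob \<kappa> n (x i) (x j) else 1 - edge_prob \<kappa> n (x i) (x j)))"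
    proof (rule sum.cong[OF refl])
      fix b assume b: "b \<in> ?B"
      have "pmf (?P x) b = (\<Prod>e\<in>vertex_pairs n.
              pmf (case e of (i, j) \<Rightarrow> bernoulli_pmf (edge_prob \<kappa> n (x i) (x j))) (b e))"
        by (rule pmf_Pi') (use b finite_vertex_pairs in auto)
      hence "ennreal (pmf (?P x) b) = (\<Prod>e\<in>vertex_pairs n. ennreal
              (pmf (case e of (i, j) \<Rightarrow> bernoulli_pmf (edge_prob \<kappa> n (x i) (x j))) (b e)))"
        by (simp add: prod_ennreal)
      also have "\<dots> = (\<Prod>(i, j)\<in>vertex_pairs n. ennreal
            (if b (i, j) then edge_prob \<kappa> n (x i) (x j) else 1 - edge_prob \<kappa> n (x i) (x j)))"
        by (intro prod.cong refl) (auto simp: edge_prob_bounds[OF nonneg])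
      finally show "ennreal (pmf (?P x) b) = (\<Prod>(i, j)\<in>vertex_pairs n. ennreal
            (if b (i, j) then edge_prob \<kappa> n (x i) (x j) else 1 - edge_prob \<kappa> n (x i) (x j)))" .
    qed
    finally show ?thesis .
  qed
  have meas: "(\<lambda>x. edge_prob \<kappa> n (x i) (x j)) \<in> borel_measurable (Pi\<^sub>M {1..n} (\<lambda>_. \<mu>))"
    if "(i, j) \<in> vertex_pairs n" for i j
  proof -
    have [measurable]: "i \<in> {1..n}" "j \<in> {1..n}"
      using that by (auto simp: vertex_pairs_def)
    have "(\<lambda>x. case_prod \<kappa> (x i, x j)) \<in> borel_measurable (Pi\<^sub>M {1..n} (\<lambda>_. \<mu>))"
      by measurable
    thus ?thesis by (simp add: edge_prob_def)
  qed
  show "(\<lambda>x. emeasure (measure_pmf (graph_given_points \<kappa> n x)) A)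
          \<in> borel_measurable (Pi\<^sub>M {1..n} (\<lambda>_. \<mu>))"
    unfolding eq
  proof (intro borel_measurable_sum borel_measurable_prod_ennreal)
    fix b :: "nat \<times> nat \<Rightarrow> bool" and e
    assume e: "e \<in> vertex_pairs n"
    obtain i j where ij: "e = (i, j)" by (cases e)
    note [measurable] = meas[OF e[unfolded ij]]
    have "(\<lambda>x. ennreal (if b (i, j) then edge_prob \<kappa> n (x i) (x j)
             else 1 - edge_prob \<kappa> n (x i) (x j))) \<in> borel_measurable (Pi\<^sub>M {1..n} (\<lambda>_. \<mu>))"
      by measurable
    thus "(\<lambda>x. case e of (i, j) \<Rightarrow> ennreal (if b (i, j) then edge_prob \<kappa> n (x i) (x j)
             else 1 - edge_prob \<kappa> n (x i) (x j))) \<in> borel_measurable (Pi\<^sub>M {1..n} (\<lambda>_. \<mu>))"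
      by (simp add: ij)
  qed
qed (auto intro: measure_pmf.subprob_space_axioms)

lemma emeasure_random_graph:
  assumes "prob_space \<mu>" "case_prod \<kappa> \<in> borel_measurable (\<mu> \<Otimes>\<^sub>M \<mu>)" "\<And>x y. 0 \<le> \<kappa> x y"
  shows "emeasure (random_graph \<mu> \<kappa> n) A =
           (\<integral>\<^sup>+ x. emeasure (measure_pmf (graph_given_points \<kappa> n x)) A \<partial>Pi\<^sub>M {1..n} (\<lambda>_. \<mu>))"
proof -
  interpret prob_space "Pi\<^sub>M {1..n} (\<lambda>_. \<mu>)"
    by (rule prob_space_PiM) (rule assms)
  show ?thesis
    unfolding random_graph_def
    by (rule emeasure_bind[OF not_empty measurable_graph_given_points[OF assms(2,3)]]) auto
qed

lemma prob_space_random_graph: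
  assumes "prob_space \<mu>" "case_prod \<kappa> \<in> borel_measurable (\<mu> \<Otimes>\<^sub>M \<mu>)" "\<And>x y. 0 \<le> \<kappa> x y"
  shows "prob_space (random_graph \<mu> \<kappa> n)"
proof -
  interpret prob_space "Pi\<^sub>M {1..n} (\<lambda>_. \<mu>)"
    by (rule prob_space_PiM) (rule assms)
  show ?thesis
    unfolding random_graph_def
    by (rule prob_space_bind[OF _ measurable_graph_given_points[OF assms(2,3)]])
      (auto intro: measure_pmf.prob_space_axioms)
qed

end

theory Submission
  imports Defs "HOL-Real_Asymp.Real_Asymp"
begin

text \<open>
  The proof is a second moment argument for isolated vertices. Since \<open>\<lambda>\<^sub>* < 1\<close> and
  \<open>\<lambda>\<^sub>2\<close> is finite almost everywhere, there are \<open>c < 1\<close>, \<open>B\<close> and a set \<open>A\<close> of positive measure on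
  which \<open>\<lambda> \<le> c\<close> and \<open>\<lambda>\<^sub>2\<^sup>2 \<le> B\<close>. Let \<open>Y\<close> be the number of isolated vertices with type in \<open>A\<close>,
  and put \<open>p = ln n / n\<close>. A vertex of type \<open>x \<in> A\<close> is isolated with probability
  \<open>a(x)\<^bsup>n-1\<^esup>\<close> where \<open>a(x) \<ge> 1 - c p\<close>, so the mean of \<open>Y\<close> is at least
  \<open>n \<mu>(A) (1 - c p)\<^sup>n\<close>, which is of order \<open>n\<^bsup>1-c\<^esup>\<close>. Two vertices of types \<open>x, y \<in> A\<close> are both
  isolated with probability at most \<open>b(x, y)\<^bsup>n-2\<^esup>\<close>, where \<open>b(x, y)\<close> is the probability that
  neither is joined to a third random point, and the bound on \<open>\<lambda>\<^sub>2\<close> gives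
  \<open>b(x, y) \<le> a(x) a(y) + B p\<^sup>2\<close>. As \<open>n p\<^sup>2 \<rightarrow> 0\<close>, the variance of \<open>Y\<close> is of smaller order than
  the square of its mean, and Chebyshev's inequality gives \<open>Y > 0\<close> with high probability.
\<close>

text \<open>
  Chebyshev's inequality for \<open>Y = \<Sum>i\<in>U. indicator (E i)\<close> on the event \<open>Y = 0\<close>, with a free
  parameter \<open>m\<close> and all terms positive, so that it can be integrated over \<open>ennreal\<close>
  before \<open>m\<close> is set to the mean of \<open>Y\<close>.
\<close>

lemma (in prob_space) second_moment_bound:
  fixes E :: "'i \<Rightarrow> 'a set" and m :: real
  assumes "finite U" and E: "\<And>i. i \<in> U \<Longrightarrow> E i \<in> events" and C: "C \<in> events"
    and disj: "\<And>i. i \<in> U \<Longrightarrow> C \<inter> E i = {}"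
  shows "m\<^sup>2 * prob C + 2 * m * (\<Sum>i\<in>U. prob (E i)) \<le> m\<^sup>2 + (\<Sum>i\<in>U. \<Sum>j\<in>U. prob (E i \<inter> E j))"
proof -
  define Y where "Y = (\<lambda>x. \<Sum>i\<in>U. indicator (E i) x :: real)"
  note [measurable] = E C
  have int_Y: "integrable M Y" "expectation Y = (\<Sum>i\<in>U. prob (E i))"
    using E by (auto simp: Y_def less_top[symmetric])
  have Y2: "(Y x)\<^sup>2 = (\<Sum>i\<in>U. \<Sum>j\<in>U. indicator (E i \<inter> E j) x)" for x
    by (simp add: Y_def power2_eq_square sum_product indicator_inter_arith)
  have int_Y2: "integrable M (\<lambda>x. (Y x)\<^sup>2)"
    "expectation (\<lambda>x. (Y x)\<^sup>2) = (\<Sum>i\<in>U. \<Sum>j\<in>U. prob (E i \<inter> E j))"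
    using E by (auto simp: Y2 less_top[symmetric])
  \<comment> \<open>On \<open>C\<close> the count \<open>Y\<close> vanishes and both sides equal
    \<open>m^2\<close>; off \<open>C\<close> the claim is \<open>(Y - m)^2 >= 0\<close>.\<close>
  have "m\<^sup>2 * indicator C x + 2 * m * Y x \<le> m\<^sup>2 + (Y x)\<^sup>2" for x
  proof (cases "x \<in> C")
    case True
    hence "Y x = 0"
      using disj by (fastforce simp: Y_def indicator_def intro!: sum.neutral)
    thus ?thesis using True by simp
  next
    case False
    thus ?thesis using sum_squares_bound[of m "Y x"] by simp
  qed
  hence "expectation (\<lambda>x. m\<^sup>2 * indicator C x + 2 * m * Y x) \<le> expectation (\<lambda>x. m\<^sup>2 + (Y x)\<^sup>2)"
    using C int_Y(1) int_Y2(1) by (intro integral_mono) (auto simp: less_top[symmetric])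
  thus ?thesis
    using C int_Y int_Y2 by (simp add: prob_space less_top[symmetric])
qed

section \<open>Isolated vertices and the pairs at a vertex\<close>

definition isolated:: "'v \<Rightarrow> 'v graph \<Rightarrow> bool" where
  "isolated i G \<longleftrightarrow> (\<forall>e\<in>snd G. i \<notin> e)"

lemma isolated_not_connected:
  assumes "isolated i G" "i \<in> fst G" "j \<in> fst G" "j \<noteq> i"
  shows "\<not> graph_connected G"
proof
  assume "graph_connected G"
  hence "(i, j) \<in> {(a, b). a \<noteq> b \<and> {a, b} \<in> snd G}\<^sup>*"
    using assms by (auto simp: graph_connected_def)
  thus False
    by (cases rule: converse_rtranclE) (use assms in \<open>auto simp: isolated_def\<close>)
qed

text \<open>Sorting by \<open>min\<close> and \<open>max\<close> produces the increasing listing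
  under which \<open>vertex_pairs\<close> stores an edge.\<close>

definition star :: "nat \<Rightarrow> nat set \<Rightarrow> (nat \<times> nat) set" where
  "star i K = (\<lambda>k. (min i k, max i k)) ` K"

lemma star_subset_vertex_pairs:
  "i \<in> {1..n} \<Longrightarrow> K \<subseteq> {1..n} - {i} \<Longrightarrow> star i K \<subseteq> vertex_pairs n"
  by (fastforce simp: star_def vertex_pairs_def min_def max_def)

text \<open>A common pair of the two stars could only be the one joining \<open>i\<close> and
  \<open>j\<close>.\<close>

lemma star_disjoint:
  "i \<noteq> j \<Longrightarrow> i \<notin> K \<Longrightarrow> j \<notin> K \<Longrightarrow> star i K \<inter> star j K = {}"
  by (auto simp: star_def min_def max_def split: if_splits)

text \<open>The symmetry of \<open>f\<close> undoes the sorting of the pairs.\<close>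

lemma prod_star:
  assumes "i \<notin> K" "\<And>a b. f (a, b) = f (b, a)"
  shows "(\<Prod>e\<in>star i K. f e) = (\<Prod>k\<in>K. f (i, k))"
proof -
  have "inj_on (\<lambda>k. (min i k, max i k)) K"
    using assms(1) by (auto simp: inj_on_def min_def max_def split: if_splits)
  hence "(\<Prod>e\<in>star i K. f e) = (\<Prod>k\<in>K. f (min i k, max i k))"
    by (simp add: star_def prod.reindex)
  also have "\<dots> = (\<Prod>k\<in>K. f (i, k))"
    using assms(2) by (intro prod.cong) (auto simp: min_def max_def)
  finally show ?thesis .
qed

subsection \<open>Asymptotics\<close>

lemma edge_scale_nonneg: "0 \<le> edge_scale n"
  by (cases n) (auto simp: edge_scale_def)

text \<open>The power behaves like \<open>exp (- c * ln n)\<close>, so the whole expression is of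
  order \<open>n powr (1 - c)\<close>. It bounds the mean number of isolated vertices from
  below.\<close>

lemma powr_scale_at_top:
  fixes c \<delta> :: real assumes "0 < c" "c < 1" "0 < \<delta>"
  shows "filterlim (\<lambda>n. real n * (\<delta> * (1 - c * edge_scale n) ^ n)) at_top sequentially"
proof -
  have "filterlim (\<lambda>n. real n * (\<delta> * (1 - c * (ln (real n) / real n)) powr real n)) at_top at_top"
    using assms by real_asymp
  moreover have "eventually (\<lambda>n. 0 < 1 - c * (ln (real n) / real n)) at_top"
    using assms by real_asymp
  hence "eventually (\<lambda>n. real n * (\<delta> * (1 - c * (ln (real n) / real n)) powr real n)
      = real n * (\<delta> * (1 - c * edge_scale n) ^ n)) sequentially"
    by eventually_elim (simp add: edge_scale_def powr_realpow)
  ultimately show ?thesis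
    by (rule filterlim_mono_eventually[OF _ order_refl order_refl])
qed

text \<open>The numerator is at most \<open>exp (4 * B * n * p^2)\<close> with
  \<open>p = edge_scale n\<close>, and \<open>n * p^2 = (ln n)^2 / n\<close> tends to 0.\<close>

lemma second_moment_ratio_tendsto:
  fixes B :: real assumes "0 \<le> B"
  shows "(\<lambda>n. (1 + 4 * B * (edge_scale n)\<^sup>2) ^ n / (1 - edge_scale n)\<^sup>2) \<longlonglongrightarrow> 1"
proof -
  have "(\<lambda>n. (1 + 4 * B * (ln (real n) / real n)\<^sup>2) powr real n / (1 - ln (real n) / real n)\<^sup>2)
      \<longlonglongrightarrow> 1"
    by real_asymp
  moreover have "(1 + 4 * B * (ln (real n) / real n)\<^sup>2) powr real n = (1 + 4 * B * (edge_scale n)\<^sup>2) ^ n" for n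
    using assms by (simp add: edge_scale_def powr_realpow add_pos_nonneg)
  ultimately show ?thesis
    by (simp add: edge_scale_def)
qed

lemma edge_scale_tendsto: "edge_scale \<longlonglongrightarrow> 0"
  unfolding edge_scale_def by real_asymp

text \<open>Since \<open>a * a' >= (1 - p)^2 >= 1/4\<close>, the additive error
  \<open>p^2 * B\<close> is at most \<open>4 * B * p^2\<close> times \<open>a * a'\<close>, which
  makes it multiplicative. Raising the exponent of \<open>a * a'\<close> from \<open>n - 2\<close>
  to \<open>n - 1\<close> costs the divisor \<open>(1 - p)^2\<close>.\<close>

lemma pair_power_le:
  fixes a a' b B p :: real
  assumes n: "n \<ge> 2" and B: "0 \<le> B" and p: "0 \<le> p" "p \<le> 1 / 2"
    and a: "1 - p \<le> a" and a': "1 - p \<le> a'"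
    and b: "0 \<le> b" "b \<le> a * a' + p\<^sup>2 * B"
  shows "b ^ (n - 2) \<le> a ^ (n - 1) * a' ^ (n - 1) * ((1 + 4 * B * p\<^sup>2) ^ n / (1 - p)\<^sup>2)"
proof -
  define q where "q = a * a'"
  have q1: "(1 - p)\<^sup>2 \<le> q"
    unfolding q_def power2_eq_square using a a' p by (intro mult_mono) auto
  have "1 / 4 \<le> (1 - p)\<^sup>2"
    using power_mono[of "1 / 2" "1 - p" 2] p by (simp add: power2_eq_square)
  with q1 have q: "1 / 4 \<le> q" "0 < q" and p1: "0 < (1 - p)\<^sup>2" by auto
  have "p\<^sup>2 * B * 1 \<le> p\<^sup>2 * B * (4 * q)"
    using q B by (intro mult_left_mono) auto
  hence "b \<le> q * (1 + 4 * B * p\<^sup>2)"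
    using b(2) by (simp add: q_def algebra_simps)
  hence "b ^ (n - 2) \<le> (q * (1 + 4 * B * p\<^sup>2)) ^ (n - 2)"
    using b(1) by (intro power_mono)
  also have "\<dots> \<le> q ^ (n - 2) * (1 + 4 * B * p\<^sup>2) ^ n"
    unfolding power_mult_distrib using q B by (intro mult_left_mono power_increasing) auto
  also have "\<dots> = q ^ (n - 2) * (1 - p)\<^sup>2 * ((1 + 4 * B * p\<^sup>2) ^ n / (1 - p)\<^sup>2)"
    using p1 by simp
  also have "\<dots> \<le> q ^ (n - 2) * q * ((1 + 4 * B * p\<^sup>2) ^ n / (1 - p)\<^sup>2)"
    using q q1 B by (intro mult_right_mono mult_left_mono) auto
  also have "q ^ (n - 2) * q = q ^ (n - 1)"
    using n by (metis Suc_diff_Suc Suc_1 Suc_le_lessD power_Suc2)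
  finally show ?thesis
    by (simp add: q_def power_mult_distrib)
qed

subsection \<open>Isolated vertices given the types\<close>

locale vertex_kernel = prob_space \<mu> for \<mu> :: "'a measure" +
  fixes \<kappa> :: "'a \<Rightarrow> 'a \<Rightarrow> real"
  assumes measurable_kernel [measurable]: "case_prod \<kappa> \<in> borel_measurable (\<mu> \<Otimes>\<^sub>M \<mu>)"
    and nonneg: "\<And>x y. 0 \<le> \<kappa> x y"
    and sym: "\<And>x y. \<kappa> x y = \<kappa> y x"
begin

definition nonadj :: "nat \<Rightarrow> 'a \<Rightarrow> 'a \<Rightarrow> real" where
  "nonadj n x y = 1 - edge_prob \<kappa> n x y"

lemma nonadj_bounds: "0 \<le> nonadj n x y" "nonadj n x y \<le> 1"
  using edge_prob_bounds[of \<kappa> n x y] nonneg by (auto simp: nonadj_def)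

lemma nonadj_sym: "nonadj n x y = nonadj n y x"
  by (simp add: nonadj_def edge_prob_def sym)

lemma measurable_nonadj [measurable]: "case_prod (nonadj n) \<in> borel_measurable (\<mu> \<Otimes>\<^sub>M \<mu>)"
  unfolding nonadj_def edge_prob_def by measurable

text \<open>Separating the edge indicators from the graph they encode turns events about the graph
  into events about independent coordinates.\<close>

definition edge_law :: "nat \<Rightarrow> (nat \<Rightarrow> 'a) \<Rightarrow> (nat \<times> nat \<Rightarrow> bool) pmf" where
  "edge_law n x =
     Pi_pmf (vertex_pairs n) False (\<lambda>(i, j). bernoulli_pmf (edge_prob \<kappa> n (x i) (x j)))"

definition edges_graph :: "nat \<Rightarrow> (nat \<times> nat \<Rightarrow> bool) \<Rightarrow> nat graph" where
  "edges_graph n b = ({1..n}, {{i, j} | i j. (i, j) \<in> vertex_pairs n \<and> b (i, j)})"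

lemma graph_given_points_eq: "graph_given_points \<kappa> n x = map_pmf (edges_graph n) (edge_law n x)"
  unfolding graph_given_points_def edge_law_def edges_graph_def ..

text \<open>The event is a box: coordinates in \<open>T\<close> are forced to be false and the
  others are free, so each of the latter contributes a factor 1.\<close>

lemma prob_no_edges:
  assumes "T \<subseteq> vertex_pairs n"
  shows "measure_pmf.prob (edge_law n x) {b. \<forall>e\<in>T. \<not> b e}
           = (\<Prod>(i, j)\<in>T. nonadj n (x i) (x j))"
proof -
  define B where "B e = (if e \<in> T then {False} else UNIV)" for e
  have "measure_pmf.prob (edge_law n x) {b. \<forall>e\<in>T. \<not> b e} =
      measure_pmf.prob (edge_law n x) (Pi (vertex_pairs n) B)"
    using assms by (intro arg_cong[where f = "measure_pmf.prob _"]) (force simp: B_def Pi_iff)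
  also have "\<dots> = (\<Prod>e\<in>vertex_pairs n. measure_pmf.prob
       (case e of (i, j) \<Rightarrow> bernoulli_pmf (edge_prob \<kappa> n (x i) (x j))) (B e))"
    unfolding edge_law_def by (rule measure_Pi_pmf_Pi[OF finite_vertex_pairs])
  also have "\<dots> = (\<Prod>e\<in>T. measure_pmf.prob
       (case e of (i, j) \<Rightarrow> bernoulli_pmf (edge_prob \<kappa> n (x i) (x j))) (B e))"
    by (intro prod.mono_neutral_right finite_vertex_pairs assms) (auto simp: B_def)
  also have "\<dots> = (\<Prod>(i, j)\<in>T. nonadj n (x i) (x j))"
    by (intro prod.cong)
      (auto simp: B_def nonadj_def measure_pmf_single edge_prob_bounds[OF nonneg])
  finally show ?thesis .
qed

lemma isolated_edges_graph:
  assumes "i \<in> {1..n}"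
  shows "isolated i (edges_graph n b) \<longleftrightarrow> (\<forall>e\<in>star i ({1..n} - {i}). \<not> b e)"
proof -
  have "e \<in> star i ({1..n} - {i}) \<longleftrightarrow> e \<in> vertex_pairs n \<and> (i = fst e \<or> i = snd e)" for e
  proof
    assume e: "e \<in> vertex_pairs n \<and> (i = fst e \<or> i = snd e)"
    define k where "k = (if i = fst e then snd e else fst e)"
    have "e = (min i k, max i k)" "k \<in> {1..n} - {i}"
      using e by (auto simp: k_def vertex_pairs_def min_def max_def split: prod.splits)
    thus "e \<in> star i ({1..n} - {i})" by (auto simp: star_def)
  qed (use assms in \<open>auto simp: star_def vertex_pairs_def min_def max_def split: if_splits\<close>)
  moreover have "isolated i (edges_graph n b) \<longleftrightarrow>
      (\<forall>e. e \<in> vertex_pairs n \<and> (i = fst e \<or> i = snd e) \<longrightarrow> \<not> b e)"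
    by (auto simp: isolated_def edges_graph_def)
  ultimately show ?thesis by blast
qed

lemma prob_isolated:
  assumes "i \<in> {1..n}"
  shows "measure_pmf.prob (graph_given_points \<kappa> n x) {G. isolated i G}
           = (\<Prod>k\<in>{1..n} - {i}. nonadj n (x i) (x k))"
proof -
  have "measure_pmf.prob (graph_given_points \<kappa> n x) {G. isolated i G}
      = measure_pmf.prob (edge_law n x) {b. \<forall>e\<in>star i ({1..n} - {i}). \<not> b e}"
    using assms by (simp add: graph_given_points_eq isolated_edges_graph vimage_def)
  also have "\<dots> = (\<Prod>(a, b)\<in>star i ({1..n} - {i}). nonadj n (x a) (x b))"
    using assms by (intro prob_no_edges star_subset_vertex_pairs) auto
  also have "\<dots> = (\<Prod>k\<in>{1..n} - {i}. nonadj n (x i) (x k))"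
    by (subst prod_star) (auto simp: nonadj_sym)
  finally show ?thesis .
qed

text \<open>The stars of \<open>i\<close> and \<open>j\<close> share only the pair joining them.
  Restricted to the other vertices they are disjoint, so independence gives a product; forgetting
  the shared pair only enlarges the event.\<close>

lemma prob_isolated_pair_le:
  assumes "i \<in> {1..n}" "j \<in> {1..n}" "i \<noteq> j"
  shows "measure_pmf.prob (graph_given_points \<kappa> n x) {G. isolated i G \<and> isolated j G}
           \<le> (\<Prod>k\<in>{1..n} - {i, j}. nonadj n (x i) (x k) * nonadj n (x j) (x k))"
proof -
  define K where "K = {1..n} - {i, j}"
  have "measure_pmf.prob (graph_given_points \<kappa> n x) {G. isolated i G \<and> isolated j G}
      \<le> measure_pmf.prob (edge_law n x) {b. \<forall>e\<in>star i K \<union> star j K. \<not> b e}"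
    unfolding graph_given_points_eq measure_map_pmf using assms
    by (intro measure_pmf.finite_measure_mono) (auto simp: isolated_edges_graph K_def star_def)
  also have "\<dots> = (\<Prod>(a, b)\<in>star i K \<union> star j K. nonadj n (x a) (x b))"
    using assms by (intro prob_no_edges Un_least star_subset_vertex_pairs) (auto simp: K_def)
  also have "\<dots> = (\<Prod>(a, b)\<in>star i K. nonadj n (x a) (x b))
       * (\<Prod>(a, b)\<in>star j K. nonadj n (x a) (x b))"
    using assms by (intro prod.union_disjoint star_disjoint) (auto simp: K_def star_def)
  also have "\<dots> = (\<Prod>k\<in>K. nonadj n (x i) (x k)) * (\<Prod>k\<in>K. nonadj n (x j) (x k))"
    by (subst (1 2) prod_star) (auto simp: nonadj_sym K_def)
  finally show ?thesis
    by (simp add: K_def prod.distrib)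
qed

lemma fst_edges_graph: "fst (edges_graph n b) = {1..n}"
  by (simp add: edges_graph_def)

text \<open>
  The second moment bound for the events that \<open>i\<close> is isolated, over the vertices \<open>i\<close> with type
  in \<open>A\<close>; dropping the factor for the edge \<open>ij\<close> leaves a product over the remaining vertices, which
  factorises after averaging over their types.
\<close>

lemma conditional_connected_bound:
  fixes m :: real and A :: "'a set"
  assumes n: "n \<ge> 2"
  defines "u \<equiv> \<lambda>i x. indicator A (x i) * (\<Prod>k\<in>{1..n} - {i}. nonadj n (x i) (x k))"
  defines "w \<equiv> \<lambda>i j x. indicator A (x i) * indicator A (x j)
                 * (\<Prod>k\<in>{1..n} - {i, j}. nonadj n (x i) (x k) * nonadj n (x j) (x k))"
  shows "m\<^sup>2 * measure_pmf.prob (graph_given_points \<kappa> n x) {G. graph_connected G}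
           + 2 * m * (\<Sum>i\<in>{1..n}. u i x)
           \<le> m\<^sup>2 + (\<Sum>i\<in>{1..n}. u i x) + (\<Sum>i\<in>{1..n}. \<Sum>j\<in>{1..n} - {i}. w i j x)"
proof -
  define U where "U = {i\<in>{1..n}. x i \<in> A}"
  define P where "P = measure_pmf.prob (graph_given_points \<kappa> n x)"
  \<comment> \<open>Fixing the vertex set makes \<open>C\<close> disjoint from the isolation events
    for every graph, and it leaves the probability unchanged because every sampled graph has this
    vertex set.\<close>
  define C where "C = {G :: nat graph. graph_connected G \<and> fst G = {1..n}}"
  have C: "P {G. graph_connected G} = P C"
    by (simp add: P_def C_def graph_given_points_eq vimage_def fst_edges_graph)
  have sum_U: "(\<Sum>i\<in>U. f i) = (\<Sum>i\<in>{1..n}. indicator A (x i) * f i)" for f :: "nat \<Rightarrow> real"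
  proof -
    have "(\<Sum>i\<in>U. f i) = (\<Sum>i\<in>{1..n}. if x i \<in> A then f i else 0)"
      unfolding U_def by (rule sum.inter_filter) simp
    also have "\<dots> = (\<Sum>i\<in>{1..n}. indicator A (x i) * f i)"
      by (intro sum.cong) auto
    finally show ?thesis .
  qed
  have u: "u i x = indicator A (x i) * P {G. isolated i G}" if "i \<in> {1..n}" for i
    using prob_isolated[OF that] by (simp add: u_def P_def)
  have w: "indicator A (x i) * (indicator A (x j) * P ({G. isolated i G} \<inter> {G. isolated j G})) \<le> w i j x"
    if "i \<in> {1..n}" "j \<in> {1..n} - {i}" for i j
    using that prob_isolated_pair_le[of i n j x]
    by (auto simp: w_def P_def indicator_def Collect_conj_eq)
  have "C \<inter> {G. isolated i G} = {}" if "i \<in> U" for i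
  proof -
    have "\<exists>j\<in>{1..n}. j \<noteq> i"
      using n by (intro bexI[of _ "if i = 1 then 2 else 1"]) auto
    thus ?thesis
      using that isolated_not_connected[of i] by (fastforce simp: C_def U_def)
  qed
  hence "m\<^sup>2 * P C + 2 * m * (\<Sum>i\<in>U. P {G. isolated i G})
      \<le> m\<^sup>2 + (\<Sum>i\<in>U. \<Sum>j\<in>U. P ({G. isolated i G} \<inter> {G. isolated j G}))"
    unfolding P_def by (intro measure_pmf.second_moment_bound) (auto simp: U_def)
  also have "(\<Sum>i\<in>U. \<Sum>j\<in>U. P ({G. isolated i G} \<inter> {G. isolated j G}))
      = (\<Sum>i\<in>{1..n}. \<Sum>j\<in>{1..n}. indicator A (x i) * (indicator A (x j)
          * P ({G. isolated i G} \<inter> {G. isolated j G})))"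
    by (simp only: sum_U sum_distrib_left)
  \<comment> \<open>On the diagonal \<open>j = i\<close> both the intersection and the squared
    indicator collapse, leaving \<open>u i x\<close>.\<close>
  also have "\<dots> = (\<Sum>i\<in>{1..n}. u i x + (\<Sum>j\<in>{1..n} - {i}. indicator A (x i)
      * (indicator A (x j) * P ({G. isolated i G} \<inter> {G. isolated j G}))))"
    by (intro sum.cong refl, subst sum.remove) (auto simp: u indicator_def)
  also have "\<dots> \<le> (\<Sum>i\<in>{1..n}. u i x + (\<Sum>j\<in>{1..n} - {i}. w i j x))"
    by (intro sum_mono add_left_mono w)
  finally show ?thesis
    by (simp add: sum_U u sum.distrib C flip: P_def)
qed

subsection \<open>Averaging over the types\<close>

text \<open>This is \<open>a(x)\<close> of the overview.\<close>

definition mean_nonadj :: "nat \<Rightarrow> 'a \<Rightarrow> real" where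
  "mean_nonadj n x = (\<integral>z. nonadj n x z \<partial>\<mu>)"

text \<open>This is \<open>b(x, y)\<close> of the overview.\<close>

definition mean_nonadj2 :: "nat \<Rightarrow> 'a \<Rightarrow> 'a \<Rightarrow> real" where
  "mean_nonadj2 n x y = (\<integral>z. nonadj n x z * nonadj n y z \<partial>\<mu>)"

lemma space_nonadj [measurable]: "x \<in> space \<mu> \<Longrightarrow> nonadj n x \<in> borel_measurable \<mu>"
  using measurable_Pair2[OF measurable_nonadj] by simp

lemma measurable_mean_nonadj [measurable]: "mean_nonadj n \<in> borel_measurable \<mu>"
  unfolding mean_nonadj_def by measurable

lemma measurable_mean_nonadj2 [measurable]:
  "case_prod (mean_nonadj2 n) \<in> borel_measurable (\<mu> \<Otimes>\<^sub>M \<mu>)"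
  unfolding mean_nonadj2_def by measurable

lemma nn_integral_nonadj:
  assumes "x \<in> space \<mu>"
  shows "(\<integral>\<^sup>+z. ennreal (nonadj n x z) \<partial>\<mu>) = ennreal (mean_nonadj n x)"
  unfolding mean_nonadj_def using assms
  by (intro nn_integral_eq_integral integrable_const_bound[where B = 1])
    (auto simp: nonadj_bounds abs_le_iff intro: order_trans[OF _ nonadj_bounds(1)])

lemma nn_integral_nonadj2:
  assumes "x \<in> space \<mu>" "y \<in> space \<mu>"
  shows "(\<integral>\<^sup>+z. ennreal (nonadj n x z * nonadj n y z) \<partial>\<mu>) = ennreal (mean_nonadj2 n x y)"
  unfolding mean_nonadj2_def using assms
  by (intro nn_integral_eq_integral integrable_const_bound[where B = 1])
    (auto simp: nonadj_bounds abs_mult intro!: mult_le_one)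

text \<open>By Fubini the type of \<open>i\<close> is integrated last; once it is frozen at
  \<open>y\<close>, the integrand is a product over \<open>n - 1\<close> independent
  coordinates.\<close>

lemma nn_integral_isolated:
  assumes i: "i \<in> {1..n}" and [measurable]: "A \<in> sets \<mu>"
  shows "(\<integral>\<^sup>+x. indicator A (x i) * ennreal (\<Prod>k\<in>{1..n} - {i}. nonadj n (x i) (x k))
            \<partial>Pi\<^sub>M {1..n} (\<lambda>_. \<mu>))
         = (\<integral>\<^sup>+y. indicator A y * ennreal (mean_nonadj n y ^ (n - 1)) \<partial>\<mu>)"
proof -
  interpret P: product_sigma_finite "\<lambda>_ :: nat. \<mu>" by standard
  define I where "I = {1..n} - {i}"
  have I: "finite I" "i \<notin> I" "{1..n} = insert i I" "card I = n - 1"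
    using i by (auto simp: I_def)
  let ?f = "\<lambda>x. indicator A (x i) * (\<Prod>k\<in>I. ennreal (nonadj n (x i) (x k)))"
  have [measurable]: "?f \<in> borel_measurable (Pi\<^sub>M (insert i I) (\<lambda>_. \<mu>))"
    by measurable
  have "(\<integral>\<^sup>+x. ?f x \<partial>Pi\<^sub>M (insert i I) (\<lambda>_. \<mu>))
      = (\<integral>\<^sup>+y. (\<integral>\<^sup>+x. ?f (x(i := y)) \<partial>Pi\<^sub>M I (\<lambda>_. \<mu>)) \<partial>\<mu>)"
    using I by (intro P.product_nn_integral_insert_rev) auto
  also have "\<dots> = (\<integral>\<^sup>+y. indicator A y * ennreal (mean_nonadj n y ^ (n - 1)) \<partial>\<mu>)"
  proof (rule nn_integral_cong)
    fix y assume y: "y \<in> space \<mu>"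
    have "?f (x(i := y)) = indicator A y * (\<Prod>k\<in>I. ennreal (nonadj n y (x k)))" for x
      using I by (auto intro!: prod.cong arg_cong2[where f = "(*)"])
    hence "(\<integral>\<^sup>+x. ?f (x(i := y)) \<partial>Pi\<^sub>M I (\<lambda>_. \<mu>))
        = indicator A y * (\<integral>\<^sup>+x. (\<Prod>k\<in>I. ennreal (nonadj n y (x k))) \<partial>Pi\<^sub>M I (\<lambda>_. \<mu>))"
      using y by (simp add: nn_integral_cmult)
    also have "\<dots> = indicator A y * (\<Prod>k\<in>I. ennreal (mean_nonadj n y))"
      using y I by (subst P.product_nn_integral_prod) (auto simp: nn_integral_nonadj)
    also have "\<dots> = indicator A y * ennreal (mean_nonadj n y ^ (n - 1))"
      by (simp add: I ennreal_power mean_nonadj_def nonadj_bounds)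
    finally show "(\<integral>\<^sup>+x. ?f (x(i := y)) \<partial>Pi\<^sub>M I (\<lambda>_. \<mu>))
        = indicator A y * ennreal (mean_nonadj n y ^ (n - 1))" .
  qed
  finally show ?thesis
    unfolding I(3)[symmetric] I_def[symmetric] by (simp add: prod_ennreal nonadj_bounds)
qed

text \<open>The same argument with two frozen types, leaving \<open>n - 2\<close> independent
  coordinates.\<close>

lemma nn_integral_isolated_pair:
  assumes ij: "i \<in> {1..n}" "j \<in> {1..n}" "i \<noteq> j" and [measurable]: "A \<in> sets \<mu>"
  shows "(\<integral>\<^sup>+x. indicator A (x i) * indicator A (x j)
              * ennreal (\<Prod>k\<in>{1..n} - {i, j}. nonadj n (x i) (x k) * nonadj n (x j) (x k))
            \<partial>Pi\<^sub>M {1..n} (\<lambda>_. \<mu>))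
         = (\<integral>\<^sup>+y. \<integral>\<^sup>+z. indicator A y * indicator A z * ennreal (mean_nonadj2 n y z ^ (n - 2)) \<partial>\<mu> \<partial>\<mu>)"
proof -
  interpret P: product_sigma_finite "\<lambda>_ :: nat. \<mu>" by standard
  define I where "I = {1..n} - {i, j}"
  have I: "finite I" "i \<notin> I" "j \<notin> I" "{1..n} = insert i (insert j I)" "card I = n - 2"
    using ij by (auto simp: I_def card_Diff_subset)
  let ?w = "\<lambda>y z t. ennreal (nonadj n y t * nonadj n z t)"
  let ?f = "\<lambda>x. indicator A (x i) * indicator A (x j) * (\<Prod>k\<in>I. ?w (x i) (x j) (x k))"
  have [measurable]: "?f \<in> borel_measurable (Pi\<^sub>M (insert i (insert j I)) (\<lambda>_. \<mu>))"
    by measurable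
  have "(\<integral>\<^sup>+x. ?f x \<partial>Pi\<^sub>M (insert i (insert j I)) (\<lambda>_. \<mu>))
      = (\<integral>\<^sup>+y. (\<integral>\<^sup>+x. ?f (x(i := y)) \<partial>Pi\<^sub>M (insert j I) (\<lambda>_. \<mu>)) \<partial>\<mu>)"
    using I ij by (intro P.product_nn_integral_insert_rev) auto
  also have "\<dots> = (\<integral>\<^sup>+y. (\<integral>\<^sup>+z. (\<integral>\<^sup>+x. ?f (x(j := z, i := y)) \<partial>Pi\<^sub>M I (\<lambda>_. \<mu>)) \<partial>\<mu>) \<partial>\<mu>)"
    using I by (intro nn_integral_cong P.product_nn_integral_insert_rev) auto
  also have "\<dots> = (\<integral>\<^sup>+y. \<integral>\<^sup>+z. indicator A y * indicator A z * ennreal (mean_nonadj2 n y z ^ (n - 2)) \<partial>\<mu> \<partial>\<mu>)"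
  proof (intro nn_integral_cong)
    fix y z assume yz: "y \<in> space \<mu>" "z \<in> space \<mu>"
    have "?f (x(j := z, i := y)) = indicator A y * indicator A z * (\<Prod>k\<in>I. ?w y z (x k))" for x
      using I ij by (auto intro!: prod.cong arg_cong2[where f = "(*)"])
    hence "(\<integral>\<^sup>+x. ?f (x(j := z, i := y)) \<partial>Pi\<^sub>M I (\<lambda>_. \<mu>))
        = indicator A y * indicator A z * (\<integral>\<^sup>+x. (\<Prod>k\<in>I. ?w y z (x k)) \<partial>Pi\<^sub>M I (\<lambda>_. \<mu>))"
      using yz by (simp add: nn_integral_cmult)
    also have "\<dots> = indicator A y * indicator A z * (\<Prod>k\<in>I. ennreal (mean_nonadj2 n y z))"
      using yz I by (subst P.product_nn_integral_prod) (auto simp: nn_integral_nonadj2)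
    also have "\<dots> = indicator A y * indicator A z * ennreal (mean_nonadj2 n y z ^ (n - 2))"
      by (simp add: I ennreal_power mean_nonadj2_def nonadj_bounds)
    finally show "(\<integral>\<^sup>+x. ?f (x(j := z, i := y)) \<partial>Pi\<^sub>M I (\<lambda>_. \<mu>))
        = indicator A y * indicator A z * ennreal (mean_nonadj2 n y z ^ (n - 2))" .
  qed
  finally show ?thesis
    unfolding I(4)[symmetric] I_def[symmetric] by (simp add: prod_ennreal nonadj_bounds)
qed

text \<open>The probability that a given vertex is isolated with type in \<open>A\<close>; the mean
  of \<open>Y\<close> is \<open>n\<close> times this.\<close>

definition first_moment :: "nat \<Rightarrow> 'a set \<Rightarrow> ennreal" where
  "first_moment n A = (\<integral>\<^sup>+y. indicator A y * ennreal (mean_nonadj n y ^ (n - 1)) \<partial>\<mu>)"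

text \<open>An upper bound for the probability that two given vertices are both isolated with types
  in \<open>A\<close>.\<close>

definition pair_moment :: "nat \<Rightarrow> 'a set \<Rightarrow> ennreal" where
  "pair_moment n A =
     (\<integral>\<^sup>+y. \<integral>\<^sup>+z. indicator A y * indicator A z * ennreal (mean_nonadj2 n y z ^ (n - 2)) \<partial>\<mu> \<partial>\<mu>)"

text \<open>The conditional second moment bound integrated over the types; by exchangeability all
  vertices, and all ordered pairs, contribute equally.\<close>

lemma connected_bound:
  fixes m :: real
  assumes n: "n \<ge> 2" and m: "m \<ge> 0" and A: "A \<in> sets \<mu>"
  shows "ennreal (m\<^sup>2) * emeasure (random_graph \<mu> \<kappa> n) {G. graph_connected G}
             + ennreal (2 * m * n) * first_moment n A
           \<le> ennreal (m\<^sup>2) + ennreal n * first_moment n A + ennreal (n * n) * pair_moment n A"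
proof -
  note [measurable] = A
  define N where "N = Pi\<^sub>M {1..n} (\<lambda>_. \<mu>)"
  interpret N: prob_space N
    unfolding N_def by (intro prob_space_PiM prob_space_axioms)
  define c where "c x = emeasure (measure_pmf (graph_given_points \<kappa> n x)) {G. graph_connected G}" for x
  define u where "u i x = indicator A (x i) * ennreal (\<Prod>k\<in>{1..n} - {i}. nonadj n (x i) (x k))" for i x
  define w where "w i j x = indicator A (x i) * indicator A (x j)
     * ennreal (\<Prod>k\<in>{1..n} - {i, j}. nonadj n (x i) (x k) * nonadj n (x j) (x k))" for i j x
  have [measurable]: "c \<in> borel_measurable N"
    unfolding c_def N_def
    by (rule measurable_compose[OF measurable_graph_given_points[OF measurable_kernel nonneg]])
      (auto intro: measurable_emeasure_subprob_algebra)
  have u_meas [measurable]: "u i \<in> borel_measurable N" if [measurable]: "i \<in> {1..n}" for i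
    unfolding u_def N_def by measurable
  have w_meas [measurable]: "w i j \<in> borel_measurable N"
    if [measurable]: "i \<in> {1..n}" "j \<in> {1..n}" for i j
    unfolding w_def N_def by measurable
  have le: "ennreal (m\<^sup>2) * c x + ennreal (2 * m) * (\<Sum>i\<in>{1..n}. u i x)
      \<le> ennreal (m\<^sup>2) + (\<Sum>i\<in>{1..n}. u i x) + (\<Sum>i\<in>{1..n}. \<Sum>j\<in>{1..n} - {i}. w i j x)" for x
    using ennreal_leI[OF conditional_connected_bound[OF n, of m x A]] m
    by (simp add: c_def u_def w_def measure_pmf.emeasure_eq_measure ennreal_mult
        prod_nonneg sum_nonneg nonadj_bounds ennreal_indicator flip: sum_ennreal)
  have u_sum: "(\<lambda>x. \<Sum>i\<in>{1..n}. u i x) \<in> borel_measurable N"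
    "(\<integral>\<^sup>+x. (\<Sum>i\<in>{1..n}. u i x) \<partial>N) = (\<Sum>i\<in>{1..n}. \<integral>\<^sup>+x. u i x \<partial>N)"
    by (intro borel_measurable_sum nn_integral_sum u_meas; assumption)+
  have w_sum: "(\<lambda>x. \<Sum>i\<in>{1..n}. \<Sum>j\<in>{1..n} - {i}. w i j x) \<in> borel_measurable N"
    by (intro borel_measurable_sum w_meas) auto
  have w_sum': "(\<integral>\<^sup>+x. (\<Sum>i\<in>{1..n}. \<Sum>j\<in>{1..n} - {i}. w i j x) \<partial>N)
      = (\<Sum>i\<in>{1..n}. \<Sum>j\<in>{1..n} - {i}. \<integral>\<^sup>+x. w i j x \<partial>N)"
    by (subst nn_integral_sum, (intro borel_measurable_sum w_meas; auto),
        intro sum.cong refl nn_integral_sum w_meas) auto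
  note [measurable] = u_sum(1) w_sum
  from le have "(\<integral>\<^sup>+x. ennreal (m\<^sup>2) * c x + ennreal (2 * m) * (\<Sum>i\<in>{1..n}. u i x) \<partial>N)
      \<le> (\<integral>\<^sup>+x. ennreal (m\<^sup>2) + (\<Sum>i\<in>{1..n}. u i x) + (\<Sum>i\<in>{1..n}. \<Sum>j\<in>{1..n} - {i}. w i j x) \<partial>N)"
    by (intro nn_integral_mono)
  also have "(\<integral>\<^sup>+x. ennreal (m\<^sup>2) * c x + ennreal (2 * m) * (\<Sum>i\<in>{1..n}. u i x) \<partial>N)
      = ennreal (m\<^sup>2) * (\<integral>\<^sup>+x. c x \<partial>N) + ennreal (2 * m) * (\<Sum>i\<in>{1..n}. \<integral>\<^sup>+x. u i x \<partial>N)"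
    by (simp add: nn_integral_add nn_integral_cmult u_sum del: One_nat_def)
  also have "(\<integral>\<^sup>+x. ennreal (m\<^sup>2) + (\<Sum>i\<in>{1..n}. u i x) + (\<Sum>i\<in>{1..n}. \<Sum>j\<in>{1..n} - {i}. w i j x) \<partial>N)
      = ennreal (m\<^sup>2) + (\<Sum>i\<in>{1..n}. \<integral>\<^sup>+x. u i x \<partial>N) + (\<Sum>i\<in>{1..n}. \<Sum>j\<in>{1..n} - {i}. \<integral>\<^sup>+x. w i j x \<partial>N)"
    by (simp add: nn_integral_add u_sum w_sum w_sum' N.emeasure_space_1 del: One_nat_def)
  also have "(\<integral>\<^sup>+x. c x \<partial>N) = emeasure (random_graph \<mu> \<kappa> n) {G. graph_connected G}"
    unfolding c_def N_def
    by (rule emeasure_random_graph[symmetric, OF prob_space_axioms measurable_kernel nonneg])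
  also have "(\<Sum>i\<in>{1..n}. \<integral>\<^sup>+x. u i x \<partial>N) = ennreal n * first_moment n A"
    unfolding u_def N_def first_moment_def
    by (simp add: nn_integral_isolated[unfolded One_nat_def] ennreal_of_nat_eq_real_of_nat)
  also have "(\<Sum>i\<in>{1..n}. \<Sum>j\<in>{1..n} - {i}. \<integral>\<^sup>+x. w i j x \<partial>N)
      = (\<Sum>i\<in>{1..n}. \<Sum>j\<in>{1..n} - {i}. pair_moment n A)"
    unfolding w_def N_def pair_moment_def
    by (intro sum.cong refl nn_integral_isolated_pair) auto
  \<comment> \<open>Adding the diagonal back replaces the count \<open>n * (n - 1)\<close> by
    \<open>n * n\<close>.\<close>
  also have "\<dots> \<le> (\<Sum>i\<in>{1..n}. \<Sum>j\<in>{1..n}. pair_moment n A)"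
    by (intro sum_mono sum_mono2) auto
  also have "\<dots> = ennreal (n * n) * pair_moment n A"
    by (simp add: ennreal_mult ennreal_of_nat_eq_real_of_nat mult.assoc)
  finally show ?thesis
    using m by (simp add: ennreal_mult mult.assoc add_left_mono)
qed

subsection \<open>Moment estimates\<close>

lemma space_kernel [measurable]: "x \<in> space \<mu> \<Longrightarrow> \<kappa> x \<in> borel_measurable \<mu>"
  using measurable_Pair2[OF measurable_kernel] by simp

lemma space_edge_prob [measurable]: "x \<in> space \<mu> \<Longrightarrow> edge_prob \<kappa> n x \<in> borel_measurable \<mu>"
  unfolding edge_prob_def by measurable

lemma edge_prob_le: "edge_prob \<kappa> n x y \<le> \<kappa> x y * edge_scale n"
  by (simp add: edge_prob_def)

lemma integrable_edge_prob:
  assumes "x \<in> space \<mu>"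
  shows "integrable \<mu> (edge_prob \<kappa> n x)"
  using assms by (intro integrable_const_bound[where B = 1])
    (auto simp: edge_prob_bounds[OF nonneg])

lemma integrable_edge_prob2:
  assumes "x \<in> space \<mu>" "y \<in> space \<mu>"
  shows "integrable \<mu> (\<lambda>z. edge_prob \<kappa> n x z * edge_prob \<kappa> n y z)"
  using assms by (intro integrable_const_bound[where B = 1])
    (auto simp: edge_prob_bounds[OF nonneg] abs_mult intro!: mult_le_one)

lemma mean_nonadj_nonneg: "0 \<le> mean_nonadj n x"
  by (auto simp: mean_nonadj_def nonadj_bounds)

lemma mean_nonadj_le_1: "mean_nonadj n x \<le> 1"
proof -
  have "mean_nonadj n x \<le> (\<integral>z. 1 \<partial>\<mu>)"
    unfolding mean_nonadj_def by (intro integral_mono') (auto simp: nonadj_bounds)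
  thus ?thesis by (simp add: prob_space)
qed

lemma mean_nonadj_ge:
  assumes x: "x \<in> space \<mu>" and c: "0 \<le> c" "kernel_deg \<mu> \<kappa> x \<le> ennreal c"
  shows "1 - c * edge_scale n \<le> mean_nonadj n x"
proof -
  note [measurable] = x
  have "ennreal (\<integral>z. edge_prob \<kappa> n x z \<partial>\<mu>) = (\<integral>\<^sup>+z. ennreal (edge_prob \<kappa> n x z) \<partial>\<mu>)"
    using x by (intro nn_integral_eq_integral[symmetric] integrable_edge_prob)
      (auto simp: edge_prob_bounds[OF nonneg])
  also have "\<dots> \<le> (\<integral>\<^sup>+z. ennreal (\<kappa> x z) * ennreal (edge_scale n) \<partial>\<mu>)"
    by (intro nn_integral_mono)
      (auto simp: nonneg edge_scale_nonneg edge_prob_le simp flip: ennreal_mult intro!: ennreal_leI)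
  also have "\<dots> = kernel_deg \<mu> \<kappa> x * ennreal (edge_scale n)"
    unfolding kernel_deg_def using x by (intro nn_integral_multc) auto
  also have "\<dots> \<le> ennreal c * ennreal (edge_scale n)"
    by (intro mult_right_mono c) auto
  finally have "(\<integral>z. edge_prob \<kappa> n x z \<partial>\<mu>) \<le> c * edge_scale n"
    using c by (simp add: edge_scale_nonneg flip: ennreal_mult)
  moreover have "mean_nonadj n x = 1 - (\<integral>z. edge_prob \<kappa> n x z \<partial>\<mu>)"
    unfolding mean_nonadj_def nonadj_def
    using integrable_edge_prob[OF x] by (simp add: prob_space)
  ultimately show ?thesis by simp
qed

text \<open>Expanding the products, \<open>b(x, y) - a(x) * a(y)\<close> is the covariance of the
  edge probabilities to a third random point, hence at most the mean of their product. That mean is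
  bounded through \<open>2 * s * t <= s^2 + t^2\<close>.\<close>

lemma mean_nonadj2_le:
  assumes x: "x \<in> space \<mu>" and y: "y \<in> space \<mu>" and B: "0 \<le> B"
    and Bx: "(\<integral>\<^sup>+z. ennreal ((\<kappa> x z)\<^sup>2) \<partial>\<mu>) \<le> ennreal B"
    and By: "(\<integral>\<^sup>+z. ennreal ((\<kappa> y z)\<^sup>2) \<partial>\<mu>) \<le> ennreal B"
  shows "mean_nonadj2 n x y \<le> mean_nonadj n x * mean_nonadj n y + (edge_scale n)\<^sup>2 * B"
proof -
  note [measurable] = x y
  let ?e = "edge_prob \<kappa> n"
  let ?s = "edge_scale n"
  have ee: "?e x z * ?e y z \<le> ?s\<^sup>2 / 2 * ((\<kappa> x z)\<^sup>2 + (\<kappa> y z)\<^sup>2)" for z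
  proof -
    have "?e x z * ?e y z \<le> (\<kappa> x z * ?s) * (\<kappa> y z * ?s)"
      by (intro mult_mono edge_prob_le mult_nonneg_nonneg edge_prob_bounds nonneg edge_scale_nonneg)
    also have "\<dots> = ?s\<^sup>2 / 2 * (2 * \<kappa> x z * \<kappa> y z)"
      by (simp add: power2_eq_square)
    also have "\<dots> \<le> ?s\<^sup>2 / 2 * ((\<kappa> x z)\<^sup>2 + (\<kappa> y z)\<^sup>2)"
      by (intro mult_left_mono sum_squares_bound) auto
    finally show ?thesis .
  qed
  have "ennreal (\<integral>z. ?e x z * ?e y z \<partial>\<mu>) = (\<integral>\<^sup>+z. ennreal (?e x z * ?e y z) \<partial>\<mu>)"
    using x y by (intro nn_integral_eq_integral[symmetric] integrable_edge_prob2)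
      (auto simp: edge_prob_bounds[OF nonneg])
  also have "\<dots> \<le> (\<integral>\<^sup>+z. ennreal (?s\<^sup>2 / 2) * (ennreal ((\<kappa> x z)\<^sup>2) + ennreal ((\<kappa> y z)\<^sup>2)) \<partial>\<mu>)"
    using ee by (intro nn_integral_mono) (simp flip: ennreal_mult ennreal_plus)
  also have "\<dots> = ennreal (?s\<^sup>2 / 2) * ((\<integral>\<^sup>+z. ennreal ((\<kappa> x z)\<^sup>2) \<partial>\<mu>) + (\<integral>\<^sup>+z. ennreal ((\<kappa> y z)\<^sup>2) \<partial>\<mu>))"
    by (simp add: nn_integral_cmult nn_integral_add)
  also have "\<dots> \<le> ennreal (?s\<^sup>2 / 2) * (ennreal B + ennreal B)"
    by (intro mult_left_mono add_mono Bx By) auto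
  also have "\<dots> = ennreal (?s\<^sup>2 * B)"
    using B by (simp flip: ennreal_mult ennreal_plus)
  finally have "(\<integral>z. ?e x z * ?e y z \<partial>\<mu>) \<le> ?s\<^sup>2 * B"
    using B by (simp add: ennreal_le_iff)
  moreover have "mean_nonadj n x = 1 - (\<integral>z. ?e x z \<partial>\<mu>)" "mean_nonadj n y = 1 - (\<integral>z. ?e y z \<partial>\<mu>)"
    unfolding mean_nonadj_def nonadj_def using integrable_edge_prob x y by (simp_all add: prob_space)
  moreover have "mean_nonadj2 n x y
      = 1 - (\<integral>z. ?e x z \<partial>\<mu>) - (\<integral>z. ?e y z \<partial>\<mu>) + (\<integral>z. ?e x z * ?e y z \<partial>\<mu>)"
  proof -
    have "mean_nonadj2 n x y = (\<integral>z. 1 - ?e x z - ?e y z + ?e x z * ?e y z \<partial>\<mu>)"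
      unfolding mean_nonadj2_def nonadj_def by (simp add: algebra_simps)
    also have "\<dots> = 1 - (\<integral>z. ?e x z \<partial>\<mu>) - (\<integral>z. ?e y z \<partial>\<mu>) + (\<integral>z. ?e x z * ?e y z \<partial>\<mu>)"
      using integrable_edge_prob x y integrable_edge_prob2[OF x y] by (simp add: prob_space)
    finally show ?thesis .
  qed
  moreover have "0 \<le> (1 - mean_nonadj n x) * (1 - mean_nonadj n y)"
    by (intro mult_nonneg_nonneg) (auto simp: mean_nonadj_le_1)
  ultimately show ?thesis
    by (simp add: algebra_simps)
qed

section \<open>From the moments to the limit\<close>

text \<open>With \<open>m\<close> the mean of \<open>Y\<close>, dividing the second moment bound by
  \<open>m^2\<close> leaves \<open>1 / m + D - 1\<close>: the diagonal contributes
  \<open>1 / m\<close>, and \<open>D\<close> bounds the ratio of the pair term to the squared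
  mean.\<close>

lemma prob_connected_le:
  fixes c B :: real
  assumes n: "n \<ge> 2" and p: "edge_scale n \<le> 1 / 2"
    and c: "0 < c" "c < 1" and B: "0 \<le> B" and A: "A \<in> sets \<mu>" "0 < prob A"
    and deg: "\<And>x. x \<in> A \<Longrightarrow> kernel_deg \<mu> \<kappa> x \<le> ennreal c"
    and deg2: "\<And>x. x \<in> A \<Longrightarrow> (\<integral>\<^sup>+z. ennreal ((\<kappa> x z)\<^sup>2) \<partial>\<mu>) \<le> ennreal B"
  shows "measure (random_graph \<mu> \<kappa> n) {G. graph_connected G}
    \<le> 1 / (n * (prob A * (1 - c * edge_scale n) ^ n))
       + (1 + 4 * B * (edge_scale n)\<^sup>2) ^ n / (1 - edge_scale n)\<^sup>2 - 1"
proof -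
  note [measurable] = A(1)
  interpret G: prob_space "random_graph \<mu> \<kappa> n"
    by (rule prob_space_random_graph[OF prob_space_axioms measurable_kernel nonneg])
  define p where "p = edge_scale n"
  define D where "D = (1 + 4 * B * p\<^sup>2) ^ n / (1 - p)\<^sup>2"
  have p0: "0 \<le> p" "p \<le> 1 / 2" using p by (auto simp: p_def edge_scale_nonneg)
  have D: "0 \<le> D" using B by (simp add: D_def)
  have A_space: "x \<in> space \<mu>" if "x \<in> A" for x
    using that A sets.sets_into_space by blast
  have cp: "c * p \<le> p" using c p0 by (simp add: mult_left_le_one_le)
  have mean: "1 - c * p \<le> mean_nonadj n x" if "x \<in> A" for x
    using that c deg A_space unfolding p_def by (intro mean_nonadj_ge) auto
  have lower: "ennreal (prob A * (1 - c * p) ^ n) \<le> first_moment n A"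
  proof -
    have "ennreal (prob A * (1 - c * p) ^ n) = (\<integral>\<^sup>+y. indicator A y * ennreal ((1 - c * p) ^ n) \<partial>\<mu>)"
      using cp p0 by (subst nn_integral_multc) (auto simp: emeasure_eq_measure ennreal_mult)
    also have "\<dots> \<le> first_moment n A"
      unfolding first_moment_def
    proof (intro nn_integral_mono, goal_cases)
      case (1 y)
      \<comment> \<open>Weakening the exponent from \<open>n - 1\<close> to \<open>n\<close> matches
        the form used in \<open>powr_scale_at_top\<close>.\<close>
      have "(1 - c * p) ^ n \<le> (1 - c * p) ^ (n - 1)"
        using cp p0 c by (intro power_decreasing) auto
      also have "y \<in> A \<Longrightarrow> \<dots> \<le> mean_nonadj n y ^ (n - 1)"
        using cp p0 mean by (intro power_mono) auto
      finally show ?case by (auto simp: indicator_def intro!: ennreal_leI)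
    qed
    finally show ?thesis .
  qed
  have upper: "pair_moment n A \<le> ennreal D * first_moment n A * first_moment n A"
  proof -
    have "pair_moment n A \<le> (\<integral>\<^sup>+y. \<integral>\<^sup>+z. (ennreal D * (indicator A y * ennreal (mean_nonadj n y ^ (n - 1))))
        * (indicator A z * ennreal (mean_nonadj n z ^ (n - 1))) \<partial>\<mu> \<partial>\<mu>)"
      unfolding pair_moment_def
    proof (intro nn_integral_mono, goal_cases)
      case (1 y z)
      show ?case
      proof (cases "y \<in> A \<and> z \<in> A")
        case True
        have "mean_nonadj2 n y z ^ (n - 2)
            \<le> mean_nonadj n y ^ (n - 1) * mean_nonadj n z ^ (n - 1) * D"
          unfolding D_def
        proof (rule pair_power_le)
          show "mean_nonadj2 n y z \<le> mean_nonadj n y * mean_nonadj n z + p\<^sup>2 * B"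
            unfolding p_def using True 1 B deg2 by (intro mean_nonadj2_le) auto
          show "0 \<le> mean_nonadj2 n y z"
            by (auto simp: mean_nonadj2_def nonadj_bounds)
          show "1 - p \<le> mean_nonadj n y" "1 - p \<le> mean_nonadj n z"
            using True mean[of y] mean[of z] cp by auto
        qed (use n B p0 in auto)
        thus ?thesis
          using True D by (auto simp: mean_nonadj_nonneg mult_ac simp flip: ennreal_mult intro!: ennreal_leI)
      qed auto
    qed
    also have "\<dots> = ennreal D * first_moment n A * first_moment n A"
      by (simp add: nn_integral_cmult nn_integral_multc first_moment_def)
    finally show ?thesis .
  qed
  \<comment> \<open>Finiteness of the first moment allows the return to real arithmetic and the
    division by \<open>m^2\<close>.\<close>
  have "first_moment n A \<le> (\<integral>\<^sup>+y. 1 \<partial>\<mu>)"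
    unfolding first_moment_def
    by (intro nn_integral_mono)
      (auto simp: indicator_def mean_nonadj_le_1 mean_nonadj_nonneg intro!: power_le_one)
  then obtain M where M: "first_moment n A = ennreal M" "0 \<le> M"
    by (cases "first_moment n A") (auto simp: emeasure_space_1 top_unique)
  define L where "L = real n * (prob A * (1 - c * p) ^ n)"
  have LM: "L \<le> n * M"
    using lower M unfolding L_def by (intro mult_left_mono) (auto simp: ennreal_le_iff)
  have L: "0 < L"
    using n A cp p0 by (auto simp: L_def)
  \<comment> \<open>The free parameter is now set to the mean of \<open>Y\<close>.\<close>
  define m where "m = real n * M"
  have m: "0 < m" "1 / m \<le> 1 / L"
    using L LM by (simp_all add: m_def frac_le)
  define P where "P = G.prob {G. graph_connected G}"
  have "ennreal (m\<^sup>2) * ennreal P + ennreal (2 * m * n) * ennreal M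
      \<le> ennreal (m\<^sup>2) + ennreal n * ennreal M + ennreal (n * n) * pair_moment n A"
    using connected_bound[OF n _ A(1), of m] m by (simp add: P_def M G.emeasure_eq_measure)
  also have "\<dots> \<le> ennreal (m\<^sup>2) + ennreal n * ennreal M + ennreal (n * n) * (ennreal D * ennreal M * ennreal M)"
    using upper by (intro add_left_mono mult_left_mono) (auto simp: M)
  finally have "m\<^sup>2 * P + 2 * m * n * M \<le> m\<^sup>2 + n * M + n * n * (D * M * M)"
    using m M D by (simp add: P_def ennreal_le_iff flip: ennreal_mult ennreal_plus)
  hence "m\<^sup>2 * P \<le> m\<^sup>2 * (1 / m + D - 1)"
    using m by (simp add: m_def algebra_simps power2_eq_square)
  hence "P \<le> 1 / m + D - 1"
    using m by (simp add: mult_le_cancel_left_pos)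
  thus ?thesis
    using m by (simp add: P_def L_def D_def p_def)
qed

lemma disconnected_tendsto:
  fixes c B :: real
  assumes c: "0 < c" "c < 1" and B: "0 \<le> B" and A: "A \<in> sets \<mu>" "0 < prob A"
    and deg: "\<And>x. x \<in> A \<Longrightarrow> kernel_deg \<mu> \<kappa> x \<le> ennreal c"
    and deg2: "\<And>x. x \<in> A \<Longrightarrow> (\<integral>\<^sup>+z. ennreal ((\<kappa> x z)\<^sup>2) \<partial>\<mu>) \<le> ennreal B"
  shows "(\<lambda>n. measure (random_graph \<mu> \<kappa> n) {G. \<not> graph_connected G}) \<longlonglongrightarrow> 1"
proof -
  define R where "R n = 1 / (n * (prob A * (1 - c * edge_scale n) ^ n))
       + (1 + 4 * B * (edge_scale n)\<^sup>2) ^ n / (1 - edge_scale n)\<^sup>2 - 1" for n :: nat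
  have compl: "measure (random_graph \<mu> \<kappa> n) {G. \<not> graph_connected G}
      = 1 - measure (random_graph \<mu> \<kappa> n) {G. graph_connected G}" for n
  proof -
    interpret P: prob_space "Pi\<^sub>M {1..n} (\<lambda>_. \<mu>)"
      by (intro prob_space_PiM prob_space_axioms)
    interpret G: prob_space "random_graph \<mu> \<kappa> n"
      by (rule prob_space_random_graph[OF prob_space_axioms measurable_kernel nonneg])
    \<comment> \<open>Every set of graphs is an event, so complements may be taken.\<close>
    have sets: "sets (random_graph \<mu> \<kappa> n) = UNIV"
      unfolding random_graph_def by (subst sets_bind[where N = "count_space UNIV"])
        (simp_all add: P.not_empty not_empty)
    hence "space (random_graph \<mu> \<kappa> n) = UNIV"
      by (metis UNIV_I sets.sets_into_space top.extremum_unique)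
    with sets show ?thesis
      using G.prob_compl[of "{G. graph_connected G}"] by (simp add: Compl_eq_Diff_UNIV[symmetric] Collect_neg_eq)
  qed
  \<comment> \<open>The reciprocal of the diverging mean bound tends to 0, and the second moment
    ratio tends to 1.\<close>
  have "R \<longlonglongrightarrow> 0 + 1 - 1"
    unfolding R_def
    by (intro tendsto_add tendsto_diff tendsto_const second_moment_ratio_tendsto B
        tendsto_divide_0[OF tendsto_const] filterlim_at_top_imp_at_infinity powr_scale_at_top c A)
  hence R: "(\<lambda>n. 1 - R n) \<longlonglongrightarrow> 1"
    by (auto intro!: tendsto_eq_intros)
  have "eventually (\<lambda>n. edge_scale n < 1 / 2) sequentially"
    by (rule order_tendstoD[OF edge_scale_tendsto]) simp
  hence "eventually (\<lambda>n. 1 - R n \<le> measure (random_graph \<mu> \<kappa> n) {G. \<not> graph_connected G}) sequentially"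
    using eventually_ge_at_top[of 2]
  proof eventually_elim
    case (elim n)
    show ?case
      using prob_connected_le[OF elim(2) less_imp_le[OF elim(1)] c B A deg deg2]
      by (simp add: compl R_def)
  qed
  moreover have "eventually (\<lambda>n. measure (random_graph \<mu> \<kappa> n) {G. \<not> graph_connected G} \<le> 1) sequentially"
    by (auto simp: compl)
  ultimately show ?thesis
    by (rule tendsto_sandwich[OF _ _ R tendsto_const])
qed

text \<open>For \<open>c\<close> strictly between the essential infimum and 1, the set where
  \<open>kernel_deg\<close> is at most \<open>c\<close> is not null. Square integrability makes the
  inner integral of the squared kernel finite almost everywhere, so bounding it by
  \<open>k = 0, 1, 2, ...\<close> exhausts that set up to a null set, and some \<open>A k\<close>
  has positive measure.\<close>

lemma small_degree_set:
  assumes L2: "in_L2 \<mu> (kernel_deg2 \<mu> \<kappa>)" and ess: "essinf \<mu> (kernel_deg \<mu> \<kappa>) < 1"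
  obtains c B A where "0 < c" "c < 1" "0 \<le> B" "A \<in> sets \<mu>" "0 < prob A"
    "\<And>x. x \<in> A \<Longrightarrow> kernel_deg \<mu> \<kappa> x \<le> ennreal c"
    "\<And>x. x \<in> A \<Longrightarrow> (\<integral>\<^sup>+z. ennreal ((\<kappa> x z)\<^sup>2) \<partial>\<mu>) \<le> ennreal B"
proof -
  let ?K = "\<lambda>x. \<integral>\<^sup>+z. ennreal ((\<kappa> x z)\<^sup>2) \<partial>\<mu>"
  have [measurable]: "kernel_deg \<mu> \<kappa> \<in> borel_measurable \<mu>" "?K \<in> borel_measurable \<mu>"
    unfolding kernel_deg_def by measurable
  obtain c' where c': "essinf \<mu> (kernel_deg \<mu> \<kappa>) < c'" "c' < 1"
    using dense[OF ess] by blast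
  then obtain c where c: "c' = ennreal c" "0 < c" "c < 1"
    by (cases c') (auto simp: ennreal_less_one_iff order_le_less)
  \<comment> \<open>Otherwise \<open>c'\<close> would belong to the set whose supremum is the
    essential infimum.\<close>
  have not_AE: "\<not> (AE x in \<mu>. c' \<le> kernel_deg \<mu> \<kappa> x)"
    using c'(1) Sup_upper[of c' "{z. AE x in \<mu>. z \<le> kernel_deg \<mu> \<kappa> x}"] by (auto simp: essinf_def)
  have "(\<integral>\<^sup>+x. ?K x \<partial>\<mu>) \<noteq> \<infinity>"
    using L2 by (auto simp: in_L2_def kernel_deg2_def ennsqrt_power2)
  hence fin: "AE x in \<mu>. ?K x \<noteq> \<infinity>"
    by (intro nn_integral_PInf_AE) auto
  define A where "A k = {x \<in> space \<mu>. kernel_deg \<mu> \<kappa> x \<le> ennreal c \<and> ?K x \<le> ennreal (real k)}" for k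
  have A: "A k \<in> sets \<mu>" for k
    unfolding A_def by measurable
  have "\<exists>k. 0 < prob (A k)"
  proof (rule ccontr)
    assume "\<not> (\<exists>k. 0 < prob (A k))"
    hence "A k \<in> null_sets \<mu>" for k
      using A[of k] by (auto simp: null_sets_def emeasure_eq_measure not_less measure_le_0_iff)
    hence "AE x in \<mu>. \<forall>k. x \<notin> A k"
      by (auto simp: AE_all_countable intro: AE_not_in)
    \<comment> \<open>If all \<open>A k\<close> were null, \<open>kernel_deg\<close> would exceed
      \<open>c\<close> almost everywhere.\<close>
    with fin AE_space have "AE x in \<mu>. c' \<le> kernel_deg \<mu> \<kappa> x"
    proof eventually_elim
      case (elim x)
      obtain r where r: "?K x = ennreal r"
        using elim by (cases "?K x") auto
      obtain k where "r \<le> real k" using real_arch_simple by blast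
      hence "?K x \<le> ennreal (real k)" by (simp add: r ennreal_leI)
      hence "\<not> kernel_deg \<mu> \<kappa> x \<le> ennreal c"
        using elim by (auto simp: A_def)
      thus ?case by (simp add: c)
    qed
    with not_AE show False by contradiction
  qed
  then obtain k where k: "0 < prob (A k)" ..
  show ?thesis
    by (rule that[OF c(2,3) of_nat_0_le_iff[of k] A k]) (simp_all add: A_def)
qed

end

theorem theorem3:
  fixes \<mu> :: "'a::metric_space measure" and \<kappa> :: "'a \<Rightarrow> 'a \<Rightarrow> real"
  assumes "separable_space (euclidean :: 'a topology)"
    and "prob_space \<mu>" and "sets \<mu> = sets borel"
    and "\<And>x y. 0 \<le> \<kappa> x y"
    and "\<And>x y. \<kappa> x y = \<kappa> y x"
    and "integrable (\<mu> \<Otimes>\<^sub>M \<mu>) (\<lambda>(x, y). \<kappa> x y)"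
    and "in_L2 \<mu> (kernel_deg2 \<mu> \<kappa>)"
    and "essinf \<mu> (kernel_deg \<mu> \<kappa>) < 1"
  shows "(\<lambda>n. measure (random_graph \<mu> \<kappa> n) {G. \<not> graph_connected G}) \<longlonglongrightarrow> 1"
proof -
  interpret prob_space \<mu> by fact
  \<comment> \<open>Joint measurability of the kernel comes from its integrability.\<close>
  interpret vertex_kernel \<mu> \<kappa>
    by unfold_locales (use assms in auto)
  from assms(7,8) show ?thesis
    by (rule small_degree_set) (rule disconnected_tendsto)
qed

end
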